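(* Let $G$ be a countable group with the property that every finitely generated subgroup of $G$ has polynomial volume-growth (equivalently, every finitely generated subgroup of $G$ contains a finite-index nilpotent subgroup). If $X$ is a standard Borel space and $G\curvearrowright X$ is any (not necessarily free) Borel action, then the orbit equivalence relation $E_G^X$ is hyperfinite.
   Context: A finitely generated group $H$ has polynomial volume-growth if there is $d\in\mathbb{N}$ such that for any (equivalently every) finite symmetric generating set $B$ of $H$ containing the identity there is $c>0$ with $|B^r|\le cr^d$ for all $r\ge1$. $E_G^X=\{(x,y)\in X\times X:\exists g\in G\ g\cdot x=y\}$. An equivalence relation on $X$ is Borel if it is a Borel subset of $X\times X$, finite if all its classes are finite, and hyperfinite if it is the union of an increasing sequence of finite Borel equivalence relations. *)

theory Defs
  imports "HOL-Analysis.Analysis" "HOL-Algebra.Group_Action" "HOL-Algebra.Generated_Groups"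
begin

section \<open>Volume growth of groups\<close>

definition finitely_generated :: "('a, 'm) monoid_scheme \<Rightarrow> bool"
  where "finitely_generated H \<longleftrightarrow>
    (\<exists>B. finite B \<and> B \<subseteq> carrier H \<and> generate H B = carrier H)"

text \<open>The set \<open>B\<^sup>r\<close> of all products of exactly \<open>r\<close> elements of \<open>B\<close>.\<close>

primrec set_pow :: "('a, 'm) monoid_scheme \<Rightarrow> 'a set \<Rightarrow> nat \<Rightarrow> 'a set"
  where
    "set_pow H B 0 = {\<one>\<^bsub>H\<^esub>}"
  | "set_pow H B (Suc r) = set_pow H B r <#>\<^bsub>H\<^esub> B"

definition finite_symmetric_generating_set :: "('a, 'm) monoid_scheme \<Rightarrow> 'a set \<Rightarrow> bool"
  where "finite_symmetric_generating_set H B \<longleftrightarrow>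
    finite B \<and> B \<subseteq> carrier H \<and> \<one>\<^bsub>H\<^esub> \<in> B \<and> (\<forall>b\<in>B. inv\<^bsub>H\<^esub> b \<in> B) \<and>
    generate H B = carrier H"

text \<open>The exponent does not depend on the choice of generating set; see
  \<open>polynomial_volume_growth_iff_every\<close> below. The definition implies finite generation.\<close>

definition polynomial_volume_growth :: "('a, 'm) monoid_scheme \<Rightarrow> bool"
  where "polynomial_volume_growth H \<longleftrightarrow>
    (\<exists>d::nat. \<exists>B. finite_symmetric_generating_set H B \<and>
      (\<exists>c::real. c > 0 \<and> (\<forall>r\<ge>1. real (card (set_pow H B r)) \<le> c * real r ^ d)))"

context group
begin

lemma set_pow_closed: "B \<subseteq> carrier G \<Longrightarrow> set_pow G B r \<subseteq> carrier G"
  by (induction r) (auto dest: set_mult_closed)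

lemma set_pow_finite: "finite B \<Longrightarrow> finite (set_pow G B r)"
  by (induction r) (auto simp: set_mult_def)

lemma set_pow_add:
  assumes "B \<subseteq> carrier G"
  shows "set_pow G B (m + n) = set_pow G B m <#> set_pow G B n"
proof (induction n)
  case 0
  have "set_pow G B m \<subseteq> carrier G" using set_pow_closed[OF assms] .
  then show ?case by (force simp: set_mult_def)
next
  case (Suc n)
  then show ?case by (simp add: set_mult_assoc set_pow_closed assms)
qed

lemma set_pow_mono:
  assumes "B \<subseteq> carrier G" "\<one> \<in> B" "m \<le> n"
  shows "set_pow G B m \<subseteq> set_pow G B n"
  using assms(3)
proof (induction rule: dec_induct)
  case (step k)
  have "set_pow G B k \<subseteq> set_pow G B k <#> B"
    using set_pow_closed[OF assms(1), of k] assms(2) by (force simp: set_mult_def)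
  then show ?case using step by simp
qed simp

lemma set_pow_mult:
  assumes "B \<subseteq> carrier G" "C \<subseteq> set_pow G B N"
  shows "set_pow G C r \<subseteq> set_pow G B (N * r)"
proof (induction r)
  case (Suc r)
  have "set_pow G B (N * Suc r) = set_pow G B (N * r) <#> set_pow G B N"
    by (metis add.commute mult_Suc_right set_pow_add assms(1))
  then show ?case
    using Suc assms(2) by (simp add: mono_set_mult)
qed simp

lemma generate_set_pow:
  assumes "finite_symmetric_generating_set G B" "x \<in> carrier G"
  shows "\<exists>n. x \<in> set_pow G B n"
proof -
  have B: "B \<subseteq> carrier G" "\<And>b. b \<in> B \<Longrightarrow> inv b \<in> B" and x: "x \<in> generate G B"
    using assms by (auto simp: finite_symmetric_generating_set_def)
  have 1: "set_pow G B 1 = B"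
    using B(1) by (force simp: set_mult_def)
  from x show ?thesis
  proof induction
    case one
    have "\<one> \<in> set_pow G B 0" by simp
    then show ?case by blast
  next
    case (incl h)
    then show ?case using 1 by blast
  next
    case (inv h)
    then show ?case using 1 B(2) by blast
  next
    case (eng h1 h2)
    then obtain m n where "h1 \<in> set_pow G B m" "h2 \<in> set_pow G B n" by blast
    then have "h1 \<otimes> h2 \<in> set_pow G B (m + n)"
      by (auto simp: set_pow_add[OF B(1)] set_mult_def)
    then show ?case by blast
  qed
qed

lemma polynomial_volume_growth_iff_every:
  "polynomial_volume_growth G \<longleftrightarrow> finitely_generated G \<and>
    (\<exists>d::nat. \<forall>B. finite_symmetric_generating_set G B \<longrightarrow>
      (\<exists>c::real. c > 0 \<and> (\<forall>r\<ge>1. real (card (set_pow G B r)) \<le> c * real r ^ d)))"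
    (is "?L \<longleftrightarrow> ?F \<and> ?R")
proof
  assume ?L
  then obtain d B c where B: "finite_symmetric_generating_set G B" and c: "c > (0::real)"
    and le: "\<And>r. r \<ge> 1 \<Longrightarrow> real (card (set_pow G B r)) \<le> c * real r ^ d"
    unfolding polynomial_volume_growth_def by blast
  have Bc: "B \<subseteq> carrier G" "\<one> \<in> B" "finite B"
    using B by (auto simp: finite_symmetric_generating_set_def)
  have ?F using B by (auto simp: finitely_generated_def finite_symmetric_generating_set_def)
  moreover have "\<exists>c::real. c > 0 \<and> (\<forall>r\<ge>1. real (card (set_pow G C r)) \<le> c * real r ^ d)"
    if C: "finite_symmetric_generating_set G C" for C
  proof -
    have Cc: "C \<subseteq> carrier G" "finite C"
      using C by (auto simp: finite_symmetric_generating_set_def)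
    then have "\<forall>x\<in>C. \<exists>n. x \<in> set_pow G B n" using generate_set_pow[OF B] by blast
    then obtain f where f: "\<And>x. x \<in> C \<Longrightarrow> x \<in> set_pow G B (f x)" by metis
    define N where "N = Suc (\<Sum>x\<in>C. f x)"
    have "f x \<le> N" if "x \<in> C" for x
      using member_le_sum[of x C f] that Cc(2) by (simp add: N_def)
    then have sub: "C \<subseteq> set_pow G B N"
      using f set_pow_mono[OF Bc(1,2)] by blast
    have "real (card (set_pow G C r)) \<le> (c * real N ^ d) * real r ^ d" if "r \<ge> 1" for r
    proof -
      have "card (set_pow G C r) \<le> card (set_pow G B (N * r))"
        by (intro card_mono set_pow_finite set_pow_mult Bc sub)
      also have "real \<dots> \<le> c * real (N * r) ^ d"
        using that by (intro le) (simp add: N_def)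
      finally show ?thesis by (simp add: power_mult_distrib mult.assoc)
    qed
    moreover have "N > 0" by (simp add: N_def)
    then have "c * real N ^ d > 0" using c by simp
    ultimately show ?thesis by blast
  qed
  ultimately show "?F \<and> ?R" by blast
next
  assume A: "?F \<and> ?R"
  then obtain S where S: "finite S" "S \<subseteq> carrier G" "generate G S = carrier G"
    by (auto simp: finitely_generated_def)
  define B where "B = insert \<one> (S \<union> m_inv G ` S)"
  have Bc: "B \<subseteq> carrier G" using S by (auto simp: B_def)
  have "carrier G \<subseteq> generate G B"
    using mono_generate[of S B] S(3) by (auto simp: B_def)
  then have "generate G B = carrier G"
    using generate_incl[OF Bc] by blast
  moreover have "\<forall>b\<in>B. inv b \<in> B"
    using S(2) by (auto simp: B_def subset_iff)
  ultimately have "finite_symmetric_generating_set G B"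
    using Bc S(1) by (auto simp: finite_symmetric_generating_set_def B_def)
  then show ?L using A unfolding polynomial_volume_growth_def by blast
qed

end

section \<open>Borel actions and hyperfiniteness\<close>

text \<open>Only the underlying measurable space of \<open>M\<close> matters here and below.\<close>

definition standard_borel_space :: "'x measure \<Rightarrow> bool"
  where "standard_borel_space M \<longleftrightarrow>
    (\<exists>T. completely_metrizable_space T \<and> separable_space T \<and>
      topspace T = space M \<and> sets M = sigma_sets (topspace T) {U. openin T U})"

text \<open>The countable group \<open>G\<close> carries its discrete Borel structure. The library's
  \<open>group_action\<close> takes each \<open>\<phi> g\<close> to be \<open>undefined\<close> outside \<open>space M\<close>.\<close>

definition borel_action ::
    "('g, 'm) monoid_scheme \<Rightarrow> 'x measure \<Rightarrow> ('g \<Rightarrow> 'x \<Rightarrow> 'x) \<Rightarrow> bool"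
  where "borel_action G M \<phi> \<longleftrightarrow>
    group_action G (space M) \<phi> \<and>
    (\<lambda>(g, x). \<phi> g x) \<in> measurable (count_space (carrier G) \<Otimes>\<^sub>M M) M"

definition orbit_equivalence_relation ::
    "('g, 'm) monoid_scheme \<Rightarrow> 'x set \<Rightarrow> ('g \<Rightarrow> 'x \<Rightarrow> 'x) \<Rightarrow> ('x \<times> 'x) set"
  where "orbit_equivalence_relation G S \<phi> =
    {(x, y) \<in> S \<times> S. \<exists>g\<in>carrier G. \<phi> g x = y}"

definition borel_equivalence_relation :: "'x measure \<Rightarrow> ('x \<times> 'x) set \<Rightarrow> bool"
  where "borel_equivalence_relation M E \<longleftrightarrow> equiv (space M) E \<and> E \<in> sets (M \<Otimes>\<^sub>M M)"

definition finite_borel_equivalence_relation :: "'x measure \<Rightarrow> ('x \<times> 'x) set \<Rightarrow> bool"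
  where "finite_borel_equivalence_relation M E \<longleftrightarrow>
    borel_equivalence_relation M E \<and> (\<forall>C\<in>space M // E. finite C)"

definition hyperfinite :: "'x measure \<Rightarrow> ('x \<times> 'x) set \<Rightarrow> bool"
  where "hyperfinite M E \<longleftrightarrow>
    equiv (space M) E \<and>
    (\<exists>F :: nat \<Rightarrow> ('x \<times> 'x) set.
      (\<forall>n. finite_borel_equivalence_relation M (F n)) \<and> incseq F \<and> E = (\<Union>n. F n))"

end

theory Submission
  imports Defs
begin

text \<open>Exhaust \<open>G\<close> by finite symmetric sets \<open>A k\<close>. It suffices to find finite Borel equivalence
  relations \<open>D n\<close> inside the orbit relation such that every related pair lies in all but finitely
  many \<open>D n\<close>; then \<open>\<Inter>m\<ge>n. D m\<close> is the required increasing sequence. Each \<open>D n\<close> is the kernel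
  of a composition over the levels \<open>k = 0, \<dots>, n\<close> of maps sending a point to the centre of a ball
  around it, of radius about \<open>R k\<close> in the word metric of \<open>A k\<close>, where the scales \<open>R k\<close> grow
  rapidly. If \<open>D n\<close> separates points near \<open>x\<close> at level \<open>k\<close>, then the sphere around one of the
  centres near \<open>x\<close> does. By polynomial growth the number of these centres is bounded by
  some \<open>b k\<close> that depends on \<open>A k\<close> but not on \<open>R k\<close>. Choosing the radii greedily so that at a given
  centre different \<open>n\<close> use disjoint spheres, at most \<open>b k\<close> of the \<open>D n\<close> cut near any point; there is
  room for this because by the same bound at level \<open>k + 1\<close> at most \<open>b (k + 1) + 1\<close> values of \<open>n\<close>
  matter at each centre.\<close>

section \<open>Word balls and doubling scales\<close>

context group
begin

lemma set_pow_one: "B \<subseteq> carrier G \<Longrightarrow> set_pow G B 1 = B"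
  by (force simp: set_mult_def)

lemma one_mem_set_pow:
  assumes "B \<subseteq> carrier G" "\<one> \<in> B"
  shows "\<one> \<in> set_pow G B m"
  using set_pow_mono[OF assms, of 0 m] by simp

lemma set_pow_mono_set: "B \<subseteq> C \<Longrightarrow> set_pow G B m \<subseteq> set_pow G C m"
  by (induction m) (simp_all add: mono_set_mult)

lemma inv_mem_set_pow:
  assumes B: "B \<subseteq> carrier G" "\<And>x. x \<in> B \<Longrightarrow> inv x \<in> B" and "x \<in> set_pow G B m"
  shows "inv x \<in> set_pow G B m"
  using assms(3)
proof (induction m arbitrary: x)
  case (Suc m)
  then obtain a c where ac: "a \<in> set_pow G B m" "c \<in> B" "x = a \<otimes> c"
    by (auto simp: set_mult_def)
  have cl: "a \<in> carrier G" "c \<in> carrier G"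
    using ac B(1) set_pow_closed[OF B(1)] by blast+
  have "inv x = inv c \<otimes> inv a"
    using cl ac(3) by (simp add: inv_mult_group)
  moreover have "set_pow G B (1 + m) = B <#> set_pow G B m"
    using set_pow_add[OF B(1), of 1 m] set_pow_one[OF B(1)] by simp
  ultimately show ?case
    using Suc.IH[OF ac(1)] B(2)[OF ac(2)] by (auto simp: set_mult_def)
qed simp

lemma set_pow_subgroup: "set_pow (G\<lparr>carrier := H\<rparr>) B m = set_pow G B m"
  by (induction m) auto

end

text \<open>If \<open>p (8 * r)\<close> exceeded \<open>2 * 8 ^ d * p r\<close> at all large scales,
  iterating along \<open>8 ^ i * s\<close> would beat the polynomial bound by a factor
  \<open>2 ^ i\<close>, up to a constant. So a single \<open>b\<close> works at arbitrarily large
  scales, though not necessarily at all of them.\<close>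

lemma polynomial_imp_doubling:
  fixes p :: "nat \<Rightarrow> nat" and c :: real
  assumes bound: "\<And>r. r \<ge> 1 \<Longrightarrow> real (p r) \<le> c * real r ^ d"
    and pos: "\<And>r. p r \<ge> 1"
  shows "\<exists>b. \<forall>r0. \<exists>r\<ge>r0. p (8 * r) \<le> b * p r"
proof (rule ccontr)
  assume "\<not> ?thesis"
  then obtain r0 where r0: "\<And>r. r \<ge> r0 \<Longrightarrow> 2 * 8 ^ d * p r < p (8 * r)"
    by (metis not_le)
  define s where "s = Suc r0"
  have "(2 * 8 ^ d) ^ i \<le> p (8 ^ i * s)" for i
  proof (induction i)
    case (Suc i)
    have "r0 \<le> 8 ^ i * s"
      using mult_le_mono1[of 1 "8 ^ i" s] by (simp add: s_def)
    then have "2 * 8 ^ d * p (8 ^ i * s) \<le> p (8 * (8 ^ i * s))"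
      using r0 by (simp add: less_imp_le)
    with mult_le_mono2[OF Suc.IH, of "2 * 8 ^ d"]
    have "2 * 8 ^ d * (2 * 8 ^ d) ^ i \<le> p (8 * (8 ^ i * s))"
      by (rule order_trans)
    then show ?case
      by (simp only: power_Suc mult.assoc)
  qed (use pos in simp)
  moreover have "real (p (8 ^ i * s)) \<le> c * real (8 ^ i * s) ^ d" for i
    by (rule bound) (simp add: s_def Suc_le_eq)
  ultimately have "real ((2 * 8 ^ d) ^ i) \<le> c * real (8 ^ i * s) ^ d" for i
    by (meson of_nat_le_iff order_trans)
  then have "2 ^ i * ((8::real) ^ i) ^ d \<le> (c * real s ^ d) * (8 ^ i) ^ d" for i
    by (simp add: power_mult_distrib mult_ac power_mult[symmetric])
  then have "2 ^ i \<le> c * real s ^ d" for i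
    by simp
  moreover obtain i where "c * real s ^ d < 2 ^ i"
    using real_arch_pow[of 2] by auto
  ultimately show False
    by (meson not_le)
qed

section \<open>Borel colourings and maximal discrete sets\<close>

locale standard_borel_action = group_action G "space M" \<phi>
  for G :: "('g, 'm) monoid_scheme" (structure) and M :: "'x measure" and \<phi> +
  fixes S :: "nat \<Rightarrow> 'x set"
  assumes measurable_action: "g \<in> carrier G \<Longrightarrow> \<phi> g \<in> measurable M M"
    and S_sets: "S i \<in> sets M"
    and S_separates: "x \<in> space M \<Longrightarrow> y \<in> space M \<Longrightarrow> x \<noteq> y \<Longrightarrow> \<exists>i. x \<in> S i \<and> y \<notin> S i"
begin

sublocale group G
  using group_hom group_hom.axioms(1) by auto

lemma action_closed: "g \<in> carrier G \<Longrightarrow> x \<in> space M \<Longrightarrow> \<phi> g x \<in> space M"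
  using element_image by blast

lemma action_one: "x \<in> space M \<Longrightarrow> \<phi> \<one> x = x"
  by (metis id_eq_one restrict_apply')

lemma action_inv: "g \<in> carrier G \<Longrightarrow> x \<in> space M \<Longrightarrow> \<phi> (inv g) (\<phi> g x) = x"
  by (metis orbit_sym_aux)

text \<open>As \<open>S\<close> separates ordered pairs, two points agree as soon as every
  \<open>S i\<close> containing the first contains the second, which is a countable Borel
  condition.\<close>

lemma pred_eq:
  assumes [measurable]: "f \<in> measurable N M" "h \<in> measurable N M"
  shows "Measurable.pred N (\<lambda>x. f x = h x)"
proof -
  note [measurable] = S_sets
  have "Measurable.pred N (\<lambda>x. \<forall>i. f x \<in> S i \<longrightarrow> h x \<in> S i)"
    by measurable
  moreover have "f x = h x \<longleftrightarrow> (\<forall>i. f x \<in> S i \<longrightarrow> h x \<in> S i)" if "x \<in> space N" for x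
    using S_separates[OF measurable_space[OF assms(1) that] measurable_space[OF assms(2) that]]
    by (cases "f x = h x") auto
  ultimately show ?thesis
    by (simp cong: measurable_cong)
qed

text \<open>Finite intersections, coded by lists, let a single index separate a point from a finite
  set, where \<open>S\<close> handles only one other point at a time.\<close>

definition cell :: "nat \<Rightarrow> 'x set"
  where "cell j = {x \<in> space M. \<forall>i\<in>set (from_nat j :: nat list). x \<in> S i}"

lemma cell_sets: "cell j \<in> sets M"
proof -
  note [measurable] = S_sets
  show ?thesis
    unfolding cell_def by measurable
qed

lemma cell_separates:
  assumes "finite F" "F \<subseteq> space M" "x \<in> space M" "x \<notin> F"
  shows "\<exists>j. x \<in> cell j \<and> F \<inter> cell j = {}"
proof -
  have "\<forall>y\<in>F. \<exists>i. x \<in> S i \<and> y \<notin> S i"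
    using assms S_separates by blast
  then obtain i where i: "\<And>y. y \<in> F \<Longrightarrow> x \<in> S (i y) \<and> y \<notin> S (i y)"
    by metis
  obtain l where "set l = i ` F"
    using finite_list[of "i ` F"] assms(1) by auto
  then show ?thesis
    using i assms(3) by (intro exI[of _ "to_nat l"]) (auto simp: cell_def)
qed

text \<open>For finite \<open>P\<close>, the cell named by the colour of a point contains it and
  omits its \<open>P\<close>-neighbours, so neighbours of equal colour coincide. Group elements
  fixing the point are exempt because the action need not be free.\<close>

definition colour :: "'g set \<Rightarrow> 'x \<Rightarrow> nat"
  where "colour P x = (LEAST j. x \<in> cell j \<and> (\<forall>g\<in>P. \<phi> g x \<noteq> x \<longrightarrow> \<phi> g x \<notin> cell j))"

lemma measurable_colour:
  assumes "finite P" "P \<subseteq> carrier G"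
  shows "colour P \<in> measurable M (count_space UNIV)"
proof -
  note [measurable] = cell_sets
  have [measurable]: "\<phi> g \<in> measurable M M" if "g \<in> P" for g
    using measurable_action assms(2) that by blast
  have [measurable]: "Measurable.pred M (\<lambda>x. \<phi> g x = x)" if "g \<in> P" for g
    using that by (intro pred_eq) auto
  show ?thesis
    unfolding colour_def using assms(1) by measurable
qed

lemma colour_proper:
  assumes P: "finite P" "P \<subseteq> carrier G"
    and "x \<in> space M" "g \<in> P" "colour P (\<phi> g x) = colour P x"
  shows "\<phi> g x = x"
proof (rule ccontr)
  assume ne: "\<phi> g x \<noteq> x"
  have ex: "y \<in> cell (colour P y) \<and> (\<forall>g\<in>P. \<phi> g y \<noteq> y \<longrightarrow> \<phi> g y \<notin> cell (colour P y))"
    if "y \<in> space M" for y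
    unfolding colour_def
  proof (rule LeastI_ex)
    have "finite ((\<lambda>g. \<phi> g y) ` P - {y})" "(\<lambda>g. \<phi> g y) ` P - {y} \<subseteq> space M"
      using P action_closed that by auto
    from cell_separates[OF this that]
    show "\<exists>j. y \<in> cell j \<and> (\<forall>g\<in>P. \<phi> g y \<noteq> y \<longrightarrow> \<phi> g y \<notin> cell j)"
      by auto
  qed
  have "\<phi> g x \<in> space M"
    using assms action_closed by blast
  then show False
    using ex[OF assms(3)] ex[of "\<phi> g x"] ne assms(4,5) by auto
qed

text \<open>Greedy construction, colour by colour. Points of one colour may enter together because
  distinct points of equal colour are not \<open>P\<close>-neighbours; no choice within a class is
  made, so every step stays Borel.\<close>

primrec net_upto :: "'g set \<Rightarrow> nat \<Rightarrow> 'x set"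
  where
    "net_upto P 0 = {}"
  | "net_upto P (Suc i) =
      net_upto P i \<union> {x \<in> space M. colour P x = i \<and> (\<forall>g\<in>P. \<phi> g x \<notin> net_upto P i)}"

definition net :: "'g set \<Rightarrow> 'x set"
  where "net P = (\<Union>i. net_upto P i)"

lemma net_sets:
  assumes "finite P" "P \<subseteq> carrier G"
  shows "net P \<in> sets M"
proof -
  have [measurable]: "\<phi> g \<in> measurable M M" if "g \<in> P" for g
    using measurable_action assms(2) that by blast
  note [measurable] = measurable_colour[OF assms]
  have "net_upto P i \<in> sets M" for i
  proof (induction i)
    case (Suc i)
    note [measurable] = Suc
    have "{x \<in> space M. colour P x = i \<and> (\<forall>g\<in>P. \<phi> g x \<notin> net_upto P i)} \<in> sets M"
      using assms(1) by measurable
    then show ?case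
      using Suc by simp
  qed simp
  then show ?thesis
    by (simp add: net_def)
qed

lemma net_subset_space: "net P \<subseteq> space M"
proof -
  have "net_upto P i \<subseteq> space M" for i
    by (induction i) auto
  then show ?thesis
    by (auto simp: net_def)
qed

lemma net_upto_mono: "i \<le> j \<Longrightarrow> net_upto P i \<subseteq> net_upto P j"
  by (rule lift_Suc_mono_le[of "net_upto P"]) auto

lemma net_stage:
  assumes "z \<in> net P"
  shows "z \<in> net_upto P (Suc (colour P z))" "\<And>g. g \<in> P \<Longrightarrow> \<phi> g z \<notin> net_upto P (colour P z)"
proof -
  have "z \<in> net_upto P i \<Longrightarrow> z \<in> net_upto P (Suc (colour P z)) \<and>
      (\<forall>g\<in>P. \<phi> g z \<notin> net_upto P (colour P z))" for i
    by (induction i) auto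
  then show "z \<in> net_upto P (Suc (colour P z))" "\<And>g. g \<in> P \<Longrightarrow> \<phi> g z \<notin> net_upto P (colour P z)"
    using assms by (auto simp: net_def)
qed

text \<open>Of two neighbours in the net with different colours, the later was tested against the
  earlier and would have been rejected; symmetry of \<open>P\<close> covers both orders. Equal
  colours force equality by \<open>colour_proper\<close>.\<close>

lemma net_discrete:
  assumes P: "finite P" "P \<subseteq> carrier G" "\<And>g. g \<in> P \<Longrightarrow> inv g \<in> P"
    and z: "z \<in> net P" "g \<in> P" "\<phi> g z \<in> net P"
  shows "\<phi> g z = z"
proof -
  have sp: "z \<in> space M" and gc: "g \<in> carrier G"
    using z P net_subset_space by auto
  have *: False if "z \<in> net P" "w \<in> net P" "h \<in> P" "\<phi> h z = w" "colour P w < colour P z" for z w h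
    using net_stage(2)[OF that(1,3)] net_stage(1)[OF that(2)]
      net_upto_mono[of "Suc (colour P w)" "colour P z" P] that by auto
  have "\<not> colour P (\<phi> g z) < colour P z"
    using *[OF z(1,3,2)] by blast
  moreover have "\<not> colour P z < colour P (\<phi> g z)"
    using *[OF z(3,1) P(3)[OF z(2)] action_inv[OF gc sp]] by blast
  ultimately show ?thesis
    using colour_proper[OF P(1,2) sp z(2)] by simp
qed

text \<open>A point is either rejected because of a neighbour already present when its colour is
  processed, or it enters then and is reached by the identity.\<close>

lemma net_maximal:
  assumes "x \<in> space M" "\<one> \<in> P"
  shows "\<exists>g\<in>P. \<phi> g x \<in> net P"
proof (cases "\<exists>g\<in>P. \<phi> g x \<in> net_upto P (colour P x)")
  case True
  then show ?thesis
    by (auto simp: net_def)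
next
  case False
  then have "x \<in> net_upto P (Suc (colour P x))"
    using assms by simp
  then have "\<phi> \<one> x \<in> net P"
    unfolding net_def using action_one[OF assms(1)] by (metis UN_I UNIV_I)
  then show ?thesis
    using assms(2) by blast
qed

end

lemma pred_le_nat:
  fixes f h :: "'x \<Rightarrow> nat"
  assumes "f \<in> measurable M (count_space UNIV)" "h \<in> measurable M (count_space UNIV)"
  shows "Measurable.pred M (\<lambda>x. f x \<le> h x)"
proof -
  have [measurable]: "Measurable.pred M (\<lambda>x. f x \<le> j)" for j
    using measurable_compose[OF assms(1), of "\<lambda>a. a \<le> j" "count_space UNIV"] by simp
  note [measurable] = assms(2)
  have "Measurable.pred M (\<lambda>x. \<exists>j. h x = j \<and> f x \<le> j)"
    by measurable
  then show ?thesis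
    by simp
qed

section \<open>Balls and separated centres at each scale\<close>

text \<open>At level \<open>k\<close> distinct centres are more than \<open>R k = 2 * r k\<close>
  apart, and variation is tested on radius \<open>t k\<close>. \<open>scale\<close> leaves room
  between \<open>R k\<close> and \<open>2 * R k\<close> for one shell of width
  \<open>2 * t k + 1\<close> per index; \<open>t_Suc\<close> adds \<open>5 * R k\<close>, which
  absorbs the displacements at level \<open>k\<close>.\<close>

locale scaled_action = standard_borel_action G M \<phi> S
  for G :: "('g, 'm) monoid_scheme" (structure) and M :: "'x measure" and \<phi> S +
  fixes A :: "nat \<Rightarrow> 'g set" and b r t :: "nat \<Rightarrow> nat"
  assumes A: "finite (A k)" "A k \<subseteq> carrier G" "\<one> \<in> A k" "\<And>g. g \<in> A k \<Longrightarrow> inv g \<in> A k"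
    and A_Suc: "A k \<subseteq> A (Suc k)"
    and scale: "(2 * t k + 1) * (b (Suc k) + 2) \<le> 2 * r k"
    and t_Suc: "t (Suc k) = t k + 10 * r k"
    and doubling: "card (set_pow G (A k) (8 * r k)) \<le> b k * card (set_pow G (A k) (r k))"
begin

abbreviation P :: "nat \<Rightarrow> nat \<Rightarrow> 'g set"
  where "P k m \<equiv> set_pow G (A k) m"

abbreviation R :: "nat \<Rightarrow> nat"
  where "R k \<equiv> 2 * r k"

definition gball :: "nat \<Rightarrow> 'x \<Rightarrow> nat \<Rightarrow> 'x set"
  where "gball k x m = (\<lambda>g. \<phi> g x) ` P k m"

lemma P_closed: "g \<in> P k m \<Longrightarrow> g \<in> carrier G"
  using set_pow_closed[OF A(2)] by blast

lemma P_subset: "P k m \<subseteq> carrier G"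
  by (rule set_pow_closed[OF A(2)])

lemma P_finite: "finite (P k m)"
  by (rule set_pow_finite[OF A(1)])

lemma P_one: "\<one> \<in> P k m"
  by (rule one_mem_set_pow[OF A(2,3)])

lemma P_inv: "g \<in> P k m \<Longrightarrow> inv g \<in> P k m"
  by (rule inv_mem_set_pow[OF A(2,4)])

lemma P_mult: "g \<in> P k m \<Longrightarrow> h \<in> P k m' \<Longrightarrow> g \<otimes> h \<in> P k (m + m')"
  by (auto simp: set_pow_add[OF A(2)] set_mult_def)

lemma P_mono: "m \<le> m' \<Longrightarrow> P k m \<subseteq> P k m'"
  by (rule set_pow_mono[OF A(2,3)])

lemma A_mono: "k \<le> k' \<Longrightarrow> A k \<subseteq> A k'"
  by (rule lift_Suc_mono_le[of A]) (rule A_Suc)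

lemma ball_finite: "finite (gball k x m)"
  by (simp add: gball_def P_finite)

lemma ball_space: "x \<in> space M \<Longrightarrow> y \<in> gball k x m \<Longrightarrow> y \<in> space M"
  using action_closed P_closed by (auto simp: gball_def)

lemma ball_self: "x \<in> space M \<Longrightarrow> x \<in> gball k x m"
  unfolding gball_def using P_one action_one by force

lemma ball_mono: "y \<in> gball k x m \<Longrightarrow> k \<le> k' \<Longrightarrow> m \<le> m' \<Longrightarrow> y \<in> gball k' x m'"
  unfolding gball_def using P_mono set_pow_mono_set[OF A_mono] by blast

lemma ball_sym: "x \<in> space M \<Longrightarrow> y \<in> gball k x m \<Longrightarrow> x \<in> gball k y m"
  unfolding gball_def using P_inv action_inv P_closed by force

lemma ball_trans:
  assumes "x \<in> space M" "y \<in> gball k x m" "z \<in> gball k y m'"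
  shows "z \<in> gball k x (m + m')"
proof -
  obtain g h where "g \<in> P k m" "y = \<phi> g x" "h \<in> P k m'" "z = \<phi> h y"
    using assms by (auto simp: gball_def)
  then have "z = \<phi> (h \<otimes> g) x" "h \<otimes> g \<in> P k (m + m')"
    using assms(1) P_closed composition_rule P_mult[of h k m' g m] by (auto simp: add.commute)
  then show ?thesis
    by (auto simp: gball_def)
qed

definition centres :: "nat \<Rightarrow> 'x set"
  where "centres k = net (P k (R k))"

lemma centres_sets: "centres k \<in> sets M"
  unfolding centres_def by (intro net_sets P_finite P_subset)

lemma centres_space: "z \<in> centres k \<Longrightarrow> z \<in> space M"
  unfolding centres_def using net_subset_space by blast

lemma centres_discrete:
  "z \<in> centres k \<Longrightarrow> z' \<in> centres k \<Longrightarrow> z' \<in> gball k z (R k) \<Longrightarrow> z' = z"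
  unfolding centres_def gball_def using net_discrete[OF P_finite P_subset P_inv] by blast

lemma ex_centre: "x \<in> space M \<Longrightarrow> \<exists>z\<in>centres k. z \<in> gball k x (R k)"
  unfolding centres_def gball_def using net_maximal P_one by blast

text \<open>Translates of \<open>P k (r k)\<close> by elements carrying \<open>x\<close> to distinct centres are disjoint, so
  packing in the group controls centres in the possibly non-free orbit.\<close>

lemma card_centres:
  assumes x: "x \<in> space M"
  shows "card (centres k \<inter> gball k x (3 * R k)) \<le> b k"
proof -
  let ?C = "centres k \<inter> gball k x (3 * R k)"
  have fin: "finite ?C"
    using ball_finite by blast
  have "\<forall>z\<in>?C. \<exists>g. g \<in> P k (3 * R k) \<and> \<phi> g x = z"
    by (auto simp: gball_def)
  then obtain g where g: "\<And>z. z \<in> ?C \<Longrightarrow> g z \<in> P k (3 * R k) \<and> \<phi> (g z) x = z"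
    by metis
  have gc: "g z \<in> carrier G" if "z \<in> ?C" for z
    using g that P_closed by blast
  have inj: "inj_on (\<lambda>(z, h). h \<otimes> g z) (?C \<times> P k (r k))"
  proof (rule inj_onI, clarify)
    fix z h z' h'
    assume zh: "z \<in> centres k" "z \<in> gball k x (3 * R k)" "h \<in> P k (r k)"
      "z' \<in> centres k" "z' \<in> gball k x (3 * R k)" "h' \<in> P k (r k)" "h \<otimes> g z = h' \<otimes> g z'"
    have hc: "h \<in> carrier G" "h' \<in> carrier G" and gz: "g z \<in> carrier G" "g z' \<in> carrier G"
      using zh P_closed gc by auto
    have "\<phi> h z = \<phi> h' z'"
      using composition_rule[OF x hc(1) gz(1)] composition_rule[OF x hc(2) gz(2)] g zh by auto
    moreover have "\<phi> h z \<in> gball k z (r k)" "\<phi> h' z' \<in> gball k z' (r k)"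
      using zh by (auto simp: gball_def)
    ultimately have "z' \<in> gball k z (r k + r k)"
      using ball_trans[of z "\<phi> h z" k "r k" z' "r k"] ball_sym[of z'] centres_space zh by simp
    then have "z' = z"
      using centres_discrete[of z k z'] zh by (simp add: mult_2)
    then show "z = z' \<and> h = h'"
      using zh(7) hc gz by simp
  qed
  have "card ?C * card (P k (r k)) = card ((\<lambda>(z, h). h \<otimes> g z) ` (?C \<times> P k (r k)))"
    by (simp only: card_image[OF inj] card_cartesian_product)
  also have "\<dots> \<le> card (P k (8 * r k))"
  proof (rule card_mono[OF P_finite], clarify)
    fix z h
    assume "z \<in> centres k" "z \<in> gball k x (3 * R k)" "h \<in> P k (r k)"
    \<comment> \<open>This radius is \<open>7 * r k\<close>, as the centres lie within
      \<open>3 * R k = 6 * r k\<close> of \<open>x\<close>; hence the factor 8 in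
      \<open>doubling\<close>.\<close>
    then have "h \<otimes> g z \<in> P k (r k + 3 * R k)"
      using g by (intro P_mult) auto
    then show "h \<otimes> g z \<in> P k (8 * r k)"
      using P_mono[of "r k + 3 * R k" "8 * r k" k] by auto
  qed
  also have "\<dots> \<le> b k * card (P k (r k))"
    by (rule doubling)
  finally have "card ?C * card (P k (r k)) \<le> b k * card (P k (r k))" .
  moreover have "card (P k (r k)) > 0"
    using P_finite P_one card_gt_0_iff by blast
  ultimately show ?thesis
    by simp
qed

text \<open>Distinct indices give spheres around \<open>z\<close> that a ball of radius \<open>t k\<close> cannot both meet.
  The indices used below turn out never to exceed the cap, which only makes the bounds on
  \<open>radius\<close> unconditional.\<close>

definition radius :: "nat \<Rightarrow> ('x \<Rightarrow> nat) \<Rightarrow> 'x \<Rightarrow> nat"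
  where "radius k i z = R k + (2 * t k + 1) * min (i z) (b (Suc k) + 1)"

text \<open>The lower bound makes the balls around centres cover the space; the upper one confines
  the candidates to a fixed finite ball.\<close>

lemma radius_bounds: "R k \<le> radius k i z" "radius k i z \<le> 2 * R k"
proof -
  have "(2 * t k + 1) * min (i z) (b (Suc k) + 1) \<le> (2 * t k + 1) * (b (Suc k) + 2)"
    by (rule mult_le_mono2) simp
  then show "R k \<le> radius k i z" "radius k i z \<le> 2 * R k"
    using scale[of k] by (simp_all add: radius_def)
qed

section \<open>Borel assignment of points to centres\<close>

definition candidates :: "nat \<Rightarrow> ('x \<Rightarrow> nat) \<Rightarrow> 'x \<Rightarrow> 'x set"
  where "candidates k i x =
    {z \<in> centres k \<inter> gball k x (2 * R k). x \<in> gball k z (radius k i z)}"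

text \<open>Two candidates of one point are within \<open>4 * R k\<close> of each other, so a proper
  colouring at distance \<open>5 * R k\<close> gives distinct candidates different
  priorities.\<close>

definition priority :: "nat \<Rightarrow> 'x \<Rightarrow> nat"
  where "priority k = colour (P k (5 * R k))"

definition centre :: "nat \<Rightarrow> ('x \<Rightarrow> nat) \<Rightarrow> 'x \<Rightarrow> 'x"
  where "centre k i x = arg_min_on (priority k) (candidates k i x)"

lemma measurable_priority: "priority k \<in> measurable M (count_space UNIV)"
  unfolding priority_def by (intro measurable_colour P_finite P_subset)

lemma priority_inj:
  assumes "z \<in> space M" "z' \<in> gball k z (5 * R k)" "priority k z' = priority k z"
  shows "z' = z"
  using assms colour_proper[OF P_finite P_subset] by (auto simp: gball_def priority_def)

lemma candidates_finite: "finite (candidates k i x)"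
  unfolding candidates_def using ball_finite by simp

lemma candidatesI:
  assumes "x \<in> space M" "z \<in> centres k" "x \<in> gball k z (radius k i z)"
  shows "z \<in> candidates k i x"
  using assms ball_mono[OF ball_sym[OF centres_space assms(3)], of k k "2 * R k"] radius_bounds
  by (auto simp: candidates_def)

lemma candidates_nonempty:
  assumes "x \<in> space M"
  shows "candidates k i x \<noteq> {}"
proof -
  obtain z where z: "z \<in> centres k" "z \<in> gball k x (R k)"
    using ex_centre[OF assms] by blast
  then have "x \<in> gball k z (radius k i z)"
    using ball_mono[OF ball_sym[OF assms z(2)]] radius_bounds(1) by blast
  then show ?thesis
    using candidatesI[OF assms z(1)] by blast
qed

lemma centre_mem: "x \<in> space M \<Longrightarrow> centre k i x \<in> candidates k i x"
  unfolding centre_def by (intro arg_min_if_finite candidates_finite candidates_nonempty)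

lemma centre_ball: "x \<in> space M \<Longrightarrow> centre k i x \<in> gball k x (2 * R k)"
  using centre_mem by (auto simp: candidates_def)

lemma centre_least:
  "x \<in> space M \<Longrightarrow> z \<in> candidates k i x \<Longrightarrow> priority k (centre k i x) \<le> priority k z"
  unfolding centre_def by (intro arg_min_least candidates_finite) auto

text \<open>\<open>arg_min_on\<close> picks an unspecified minimiser, but two minimisers have equal
  priority and lie within \<open>5 * R k\<close>, so they coincide.\<close>

lemma centre_eqI:
  assumes x: "x \<in> space M" and z: "z \<in> candidates k i x"
    and least: "\<And>z'. z' \<in> candidates k i x \<Longrightarrow> priority k z \<le> priority k z'"
  shows "centre k i x = z"
proof -
  have zs: "z \<in> space M"
    using z centres_space by (auto simp: candidates_def)
  have "x \<in> gball k z (2 * R k)"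
    using z x by (auto simp: candidates_def intro: ball_sym)
  then have "centre k i x \<in> gball k z (2 * R k + 2 * R k)"
    by (rule ball_trans[OF zs _ centre_ball[OF x]])
  then have "centre k i x \<in> gball k z (5 * R k)"
    by (rule ball_mono) auto
  moreover have "priority k (centre k i x) = priority k z"
    using centre_least[OF x z] least[OF centre_mem[OF x]] by simp
  ultimately show ?thesis
    using priority_inj[OF zs] by blast
qed

text \<open>All candidates of \<open>x\<close> have the form \<open>\<phi> h x\<close> with
  \<open>h\<close> in the finite set \<open>N\<close>, and the minimiser is unique, so the centre
  lying in \<open>B\<close> is a finite Boolean combination of Borel conditions.\<close>

lemma measurable_centre:
  assumes [measurable]: "i \<in> measurable M (count_space UNIV)"
  shows "centre k i \<in> measurable M M"
proof (rule measurableI)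
  fix x assume "x \<in> space M"
  then show "centre k i x \<in> space M"
    using ball_space[OF _ centre_ball] by blast
next
  fix B assume [measurable]: "B \<in> sets M"
  define N where "N = P k (2 * R k)"
  have N: "finite N" "\<And>g. g \<in> N \<Longrightarrow> g \<in> carrier G"
    unfolding N_def by (auto simp: P_finite P_closed)
  note [measurable] = measurable_priority[of k] centres_sets[of k]
  have act [measurable]: "\<phi> g \<in> measurable M M" if "g \<in> N" for g
    using N that measurable_action by blast
  define Q where "Q h x \<longleftrightarrow> \<phi> h x \<in> centres k \<and>
    (\<exists>g\<in>N. \<phi> g (\<phi> h x) = x \<and> g \<in> P k (radius k i (\<phi> h x)))" for h x
  have [measurable]: "Measurable.pred M (\<lambda>x. \<phi> g (\<phi> h x) = x)" if "g \<in> N" "h \<in> N" for g h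
    using that by (intro pred_eq measurable_compose[OF act act]) auto
  have rad: "(\<lambda>x. radius k i (\<phi> h x)) \<in> measurable M (count_space UNIV)" if "h \<in> N" for h
    using that unfolding radius_def by measurable
  have [measurable]: "Measurable.pred M (\<lambda>x. g \<in> P k (radius k i (\<phi> h x)))" if "h \<in> N" for g h
    using measurable_compose[OF rad[OF that], of "\<lambda>m. g \<in> P k m" "count_space UNIV"] by simp
  have [measurable]: "Measurable.pred M (Q h)" if "h \<in> N" for h
    unfolding Q_def using N(1) that by measurable
  have prio: "(\<lambda>x. priority k (\<phi> g x)) \<in> measurable M (count_space UNIV)" if "g \<in> N" for g
    using that by measurable
  have [measurable]: "Measurable.pred M (\<lambda>x. priority k (\<phi> g x) \<le> priority k (\<phi> h x))"
    if "g \<in> N" "h \<in> N" for g h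
    using that by (intro pred_le_nat prio)
  have Q: "Q h x \<longleftrightarrow> \<phi> h x \<in> candidates k i x" if "h \<in> N" "x \<in> space M" for h x
  proof -
    \<comment> \<open>The radius varies with the centre but never exceeds \<open>2 * R k\<close>, so
      quantifying over the fixed set \<open>N\<close> loses nothing.\<close>
    have "P k (radius k i (\<phi> h x)) \<subseteq> N"
      unfolding N_def by (intro P_mono radius_bounds)
    then have "(\<exists>g\<in>N. \<phi> g (\<phi> h x) = x \<and> g \<in> P k (radius k i (\<phi> h x))) \<longleftrightarrow>
        x \<in> gball k (\<phi> h x) (radius k i (\<phi> h x))"
      unfolding gball_def image_iff by (metis subsetD)
    moreover have "\<phi> h x \<in> gball k x (2 * R k)"
      using that(1) unfolding N_def gball_def by (rule imageI)
    ultimately show ?thesis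
      unfolding Q_def candidates_def by simp
  qed
  have cand: "z \<in> candidates k i x \<Longrightarrow> \<exists>h\<in>N. z = \<phi> h x" for z x
    by (auto simp: candidates_def gball_def N_def)
  have "centre k i x \<in> B \<longleftrightarrow> (\<exists>g\<in>N. \<phi> g x \<in> B \<and> Q g x \<and>
      (\<forall>h\<in>N. Q h x \<longrightarrow> priority k (\<phi> g x) \<le> priority k (\<phi> h x)))"
    if x: "x \<in> space M" for x
  proof
    assume B: "centre k i x \<in> B"
    obtain g where g: "g \<in> N" "centre k i x = \<phi> g x"
      using cand[OF centre_mem[OF x]] by blast
    then show "\<exists>g\<in>N. \<phi> g x \<in> B \<and> Q g x \<and>
        (\<forall>h\<in>N. Q h x \<longrightarrow> priority k (\<phi> g x) \<le> priority k (\<phi> h x))"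
      using B Q x centre_mem[OF x, of k i] centre_least[OF x] by metis
  next
    assume "\<exists>g\<in>N. \<phi> g x \<in> B \<and> Q g x \<and>
        (\<forall>h\<in>N. Q h x \<longrightarrow> priority k (\<phi> g x) \<le> priority k (\<phi> h x))"
    then obtain g where g: "g \<in> N" "\<phi> g x \<in> B" "Q g x"
      "\<And>h. h \<in> N \<Longrightarrow> Q h x \<Longrightarrow> priority k (\<phi> g x) \<le> priority k (\<phi> h x)"
      by blast
    have "centre k i x = \<phi> g x"
      using g x Q cand by (intro centre_eqI) blast+
    then show "centre k i x \<in> B"
      using g(2) by simp
  qed
  then have "centre k i -` B \<inter> space M = {x \<in> space M. \<exists>g\<in>N. \<phi> g x \<in> B \<and> Q g x \<and>
      (\<forall>h\<in>N. Q h x \<longrightarrow> priority k (\<phi> g x) \<le> priority k (\<phi> h x))}"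
    by auto
  also have "\<dots> \<in> sets M"
    using N(1) by measurable
  finally show "centre k i -` B \<inter> space M \<in> sets M" .
qed

text \<open>Otherwise \<open>centre k i y\<close> would be a candidate for \<open>y'\<close> as
  well, with priority no worse than the winner's, and hence the centre of \<open>y'\<close>. So a
  split at level \<open>k\<close> is caused by a single sphere, the one around the centre of better
  priority.\<close>

lemma centre_split:
  assumes y: "y \<in> space M" "y' \<in> space M" and ne: "centre k i y \<noteq> centre k i y'"
    and close: "y' \<in> gball k y (R k)"
    and le: "priority k (centre k i y) \<le> priority k (centre k i y')"
  shows "y' \<notin> gball k (centre k i y) (radius k i (centre k i y))"
proof
  define z where "z = centre k i y"
  assume "y' \<in> gball k (centre k i y) (radius k i (centre k i y))"
  then have "z \<in> candidates k i y'"
    using candidatesI[OF y(2)] centre_mem[OF y(1)] by (auto simp: candidates_def z_def)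
  then have "centre k i y' = z"
  proof (intro centre_eqI[OF y(2)])
    fix z' assume "z' \<in> candidates k i y'"
    then show "priority k z \<le> priority k z'"
      using le centre_least[OF y(2)] by (force simp: z_def)
  qed
  then show False
    using ne by (simp add: z_def)
qed

section \<open>Composite maps and the stages that vary near a point\<close>

definition varies :: "nat \<Rightarrow> ('x \<Rightarrow> 'x) \<Rightarrow> 'x \<Rightarrow> nat \<Rightarrow> bool"
  where "varies k h x m \<longleftrightarrow> (\<exists>y\<in>gball k x m. h y \<noteq> h x)"

lemma measurable_varies:
  assumes [measurable]: "h \<in> measurable M M"
  shows "Measurable.pred M (\<lambda>x. varies k h x m)"
proof -
  have "Measurable.pred M (\<lambda>x. h (\<phi> g x) = h x)" if "g \<in> P k m" for g
    using that by (intro pred_eq measurable_compose[OF measurable_action assms] assms P_closed)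
  then have [measurable]: "Measurable.pred M (\<lambda>x. \<not> h (\<phi> g x) = h x)" if "g \<in> P k m" for g
    using that by measurable
  show ?thesis
    unfolding varies_def gball_def bex_simps using P_finite by measurable
qed

text \<open>The index of \<open>z\<close> at stage \<open>n\<close> is the number of earlier stages that still vary near \<open>z\<close>.\<close>

function stage :: "nat \<Rightarrow> nat \<Rightarrow> 'x \<Rightarrow> 'x"
  where "stage n k = (if n < k then id else stage n (Suc k) \<circ>
    centre k (\<lambda>z. \<Sum>n'=k..<n. if varies k (stage n' (Suc k)) z (5 * R k) then 1 else 0))"
  by auto
termination
  by (relation "Wellfounded.measure (\<lambda>(n, k). Suc n - k)") auto

declare stage.simps [simp del]

lemma varies_mono:
  "varies k h x m \<Longrightarrow> k \<le> k' \<Longrightarrow> m \<le> m' \<Longrightarrow> varies k' h x m'"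
  unfolding varies_def using ball_mono by blast

lemma t_le_R: "2 * t k \<le> R k"
proof -
  have "(2 * t k + 1) * 1 \<le> (2 * t k + 1) * (b (Suc k) + 2)"
    by (rule mult_le_mono2) simp
  from order_trans[OF this scale] show ?thesis
    by simp
qed

lemma stage_Suc:
  "k \<le> n \<Longrightarrow> stage n k = stage n (Suc k) \<circ>
    centre k (\<lambda>z. \<Sum>n'=k..<n. if varies k (stage n' (Suc k)) z (5 * R k) then 1 else 0)"
  by (simp add: stage.simps[of n k])

text \<open>The point whose centre has the smaller priority supplies \<open>z\<close>, by
  \<open>centre_split\<close>. As \<open>2 * t k \<le> R k\<close>, this \<open>z\<close> is within
  \<open>t k + 2 * R k \<le> 3 * R k\<close> of \<open>x\<close>, and the other centre is within
  \<open>4 * R k + 2 * t k \<le> 5 * R k\<close> of \<open>z\<close>.\<close>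

lemma separating_centre:
  assumes x: "x \<in> space M" and u: "u \<in> gball k x (t k)" "u' \<in> gball k x (t k)"
    and ne: "h (centre k i u) \<noteq> h (centre k i u')"
  shows "\<exists>z \<in> centres k \<inter> gball k x (3 * R k). varies k h z (5 * R k) \<and>
    (\<exists>v v'. v \<in> gball k x (t k) \<and> v' \<in> gball k x (t k) \<and>
      v \<in> gball k z (radius k i z) \<and> v' \<notin> gball k z (radius k i z))"
proof -
  have *: ?thesis
    if u: "u \<in> gball k x (t k)" "u' \<in> gball k x (t k)"
      and ne: "h (centre k i u) \<noteq> h (centre k i u')"
      and le: "priority k (centre k i u) \<le> priority k (centre k i u')" for u u'
  proof -
    have sp: "u \<in> space M" "u' \<in> space M"
      using ball_space[OF x] u by auto
    have uu: "u' \<in> gball k u (2 * t k)"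
      using ball_trans[OF sp(1) ball_sym[OF x u(1)] u(2)] by (simp add: mult_2)
    define z where "z = centre k i u"
    have zu: "z \<in> gball k u (2 * R k)"
      unfolding z_def by (rule centre_ball[OF sp(1)])
    have zs: "z \<in> space M"
      using ball_space[OF sp(1) zu] .
    have "z \<in> centres k" "u \<in> gball k z (radius k i z)"
      using centre_mem[OF sp(1)] by (auto simp: candidates_def z_def)
    moreover have "z \<in> gball k x (3 * R k)"
      by (rule ball_mono[OF ball_trans[OF x u(1) zu]]) (use t_le_R[of k] in auto)
    moreover have "u' \<notin> gball k z (radius k i z)"
      unfolding z_def using le ne sp ball_mono[OF uu _ t_le_R] by (intro centre_split) auto
    moreover have "varies k h z (5 * R k)"
    proof -
      have "centre k i u' \<in> gball k u (2 * t k + 2 * R k)"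
        by (rule ball_trans[OF sp(1) uu centre_ball[OF sp(2)]])
      then have "centre k i u' \<in> gball k z (2 * R k + (2 * t k + 2 * R k))"
        by (rule ball_trans[OF zs ball_sym[OF sp(1) zu]])
      then have "centre k i u' \<in> gball k z (5 * R k)"
        by (rule ball_mono) (use t_le_R[of k] in auto)
      then show ?thesis
        using ne unfolding varies_def z_def by metis
    qed
    ultimately show ?thesis
      using u by blast
  qed
  show ?thesis
    using *[OF u ne] *[OF u(2,1) ne[symmetric]] by linarith
qed

text \<open>Downward induction on \<open>k\<close>, starting at \<open>k = N + 1\<close>: the bound for \<open>k + 1\<close> keeps the indices at
  level \<open>k\<close> below the cap, so each centre near \<open>x\<close> can be responsible for only one varying
  stage. The resulting bound does not depend on \<open>N\<close>.\<close>

lemma card_varying_stages: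
  assumes "x \<in> space M"
  shows "card {n \<in> {k..N}. varies k (stage n k) x (t k)} \<le> b k"
  using assms
proof (induction "Suc N - k" arbitrary: k x)
  case 0
  then show ?case
    by simp
next
  case (Suc d)
  then have IH: "card {n \<in> {Suc k..N}. varies (Suc k) (stage n (Suc k)) z (t (Suc k))} \<le> b (Suc k)"
    if "z \<in> space M" for z
    using that by simp
  define hit where "hit n z \<longleftrightarrow> varies k (stage n (Suc k)) z (5 * R k)" for n z
  define i where "i n z = (\<Sum>n'=k..<n. if hit n' z then 1 else 0 :: nat)" for n z
  have stage: "stage n k = stage n (Suc k) \<circ> centre k (i n)" if "k \<le> n" for n
    using stage_Suc[OF that] by (simp add: i_def[abs_def] hit_def)
  \<comment> \<open>A hit on radius \<open>5 * R k\<close> is a variation on radius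
    \<open>t (Suc k)\<close>, so the induction hypothesis counts it, except for stage
    \<open>k\<close> itself, which gives the extra 1.\<close>
  have i_le: "i n z \<le> b (Suc k) + 1" if "n \<le> N" "z \<in> space M" for n z
  proof -
    let ?B = "{n \<in> {Suc k..N}. varies (Suc k) (stage n (Suc k)) z (t (Suc k))}"
    have "i n z = card {n' \<in> {k..<n}. hit n' z}"
      by (simp add: i_def sum.If_cases Int_def)
    also have "\<dots> \<le> card (insert k ?B)"
    proof (rule card_mono)
      show "{n' \<in> {k..<n}. hit n' z} \<subseteq> insert k ?B"
        using that(1) t_Suc[of k] by (auto simp: hit_def intro: varies_mono)
    qed simp
    also have "\<dots> \<le> card ?B + 1"
      by (simp add: card_insert_if)
    finally show ?thesis
      using IH[OF that(2)] by simp
  qed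
  let ?bad = "{n \<in> {k..N}. varies k (stage n k) x (t k)}"
  let ?C = "centres k \<inter> gball k x (3 * R k)"
  define sep where "sep n z \<longleftrightarrow> (\<exists>v v'. v \<in> gball k x (t k) \<and> v' \<in> gball k x (t k) \<and>
      v \<in> gball k z (radius k (i n) z) \<and> v' \<notin> gball k z (radius k (i n) z))" for n z
  have "\<exists>z. z \<in> ?C \<and> hit n z \<and> sep n z" if n: "n \<in> ?bad" for n
  proof -
    obtain y where "y \<in> gball k x (t k)" "stage n k y \<noteq> stage n k x"
      using n by (auto simp: varies_def)
    then have "\<exists>z\<in>?C. hit n z \<and> sep n z"
      unfolding hit_def sep_def using n stage[of n] ball_self[OF Suc.prems]
      by (intro separating_centre[OF Suc.prems, of y k x]) auto
    then show ?thesis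
      by blast
  qed
  then have "\<forall>n\<in>?bad. \<exists>z. z \<in> ?C \<and> hit n z \<and> sep n z"
    by blast
  then obtain z where z: "\<And>n. n \<in> ?bad \<Longrightarrow> z n \<in> ?C \<and> hit n (z n) \<and> sep n (z n)"
    using bchoice[of ?bad "\<lambda>n z. z \<in> ?C \<and> hit n z \<and> sep n z"] by blast
  have clash: False if n: "n \<in> ?bad" "n' \<in> ?bad" "n < n'" "z n = z n'" for n n'
  proof -
    have zs: "z n \<in> space M"
      using z[OF n(1)] centres_space by blast
    \<comment> \<open>Stage \<open>n\<close> is a hit at \<open>z n\<close> that \<open>i n'\<close>
      counts and \<open>i n\<close> does not, so the index strictly increases.\<close>
    have "i n' (z n) = i n (z n) + (\<Sum>m=n..<n'. if hit m (z n) then 1 else 0)"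
      unfolding i_def using n by (subst sum.atLeastLessThan_concat) auto
    moreover have "(if hit n (z n) then 1 else 0) \<le> (\<Sum>m=n..<n'. if hit m (z n) then 1 else 0 :: nat)"
      by (rule member_le_sum) (use n in auto)
    ultimately have "i n (z n) + 1 \<le> i n' (z n)"
      using z[OF n(1)] by simp
    then have "(2 * t k + 1) * (i n (z n) + 1) \<le> (2 * t k + 1) * i n' (z n)"
      by (rule mult_le_mono2)
    \<comment> \<open>Neither index exceeds the cap, so the increase survives \<open>min\<close> and
      becomes a gap of at least \<open>2 * t k\<close> between the radii.\<close>
    moreover have "i n (z n) \<le> b (Suc k) + 1" "i n' (z n) \<le> b (Suc k) + 1"
      using i_le zs n by auto
    ultimately have rad: "radius k (i n) (z n) + 2 * t k \<le> radius k (i n') (z n)"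
      by (simp add: radius_def)
    \<comment> \<open>\<open>v\<close> lies inside the smaller ball and \<open>v'\<close> outside
      the larger one, yet both are within \<open>t k\<close> of \<open>x\<close>.\<close>
    obtain v where v: "v \<in> gball k x (t k)" "v \<in> gball k (z n) (radius k (i n) (z n))"
      using z[OF n(1)] unfolding sep_def by blast
    obtain v' where v': "v' \<in> gball k x (t k)" "v' \<notin> gball k (z n) (radius k (i n') (z n))"
      using z[OF n(2)] n(4) unfolding sep_def by auto
    have "v' \<in> gball k v (t k + t k)"
      using ball_trans[OF _ ball_sym[OF Suc.prems v(1)] v'(1)] ball_space[OF Suc.prems v(1)] by blast
    then have "v' \<in> gball k (z n) (radius k (i n) (z n) + (t k + t k))"
      by (rule ball_trans[OF zs v(2)])
    then show False
      using v'(2) ball_mono[OF _ order_refl rad] by (simp add: mult_2)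
  qed
  have "inj_on z ?bad"
  proof (rule inj_onI)
    fix n n' assume nn: "n \<in> ?bad" "n' \<in> ?bad" "z n = z n'"
    show "n = n'"
      using clash[OF nn(1,2) _ nn(3)] clash[OF nn(2,1) _ nn(3)[symmetric]]
      by (cases n n' rule: linorder_cases) auto
  qed
  then have "card ?bad \<le> card ?C"
    by (rule card_inj_on_le) (use z ball_finite in auto)
  then show ?case
    using card_centres[OF Suc.prems, of k] by simp
qed

lemma finite_varying_stages:
  assumes "x \<in> space M"
  shows "finite {n. k \<le> n \<and> varies k (stage n k) x (t k)}" (is "finite ?V")
proof (rule ccontr)
  assume "infinite ?V"
  then obtain B where B: "finite B" "card B = Suc (b k)" "B \<subseteq> ?V"
    by (meson infinite_arbitrarily_large)
  then have "B \<subseteq> {n \<in> {k..Max B}. varies k (stage n k) x (t k)}"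
    by auto
  then have "card B \<le> card {n \<in> {k..Max B}. varies k (stage n k) x (t k)}"
    by (rule card_mono[rotated]) simp
  then show False
    using card_varying_stages[OF assms, of k "Max B"] B(2) by simp
qed

text \<open>\<open>centre j\<close> moves points by at most \<open>2 * R j\<close>, and
  \<open>t j + 2 * R j \<le> t (Suc j)\<close>, so the image of the \<open>t j\<close>-ball stays
  inside the \<open>t (Suc j)\<close>-ball. Measuring all levels in the larger generating set
  \<open>A K\<close> lets constancy descend from level \<open>K\<close> to level 0.\<close>

lemma stage_constant_below:
  assumes x: "x \<in> space M" and const: "\<not> varies K (stage n K) x (t K)"
    and "K \<le> n" "j \<le> K" "y \<in> gball K x (t j)"
  shows "stage n j y = stage n j x"
  using assms(4,5)
proof (induction j arbitrary: y rule: inc_induct)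
  case base
  then show ?case
    using const by (auto simp: varies_def)
next
  case (step j)
  obtain i where i: "stage n j = stage n (Suc j) \<circ> centre j i"
    using stage_Suc[of j n] step.hyps \<open>K \<le> n\<close> by auto
  have "stage n (Suc j) (centre j i w) = stage n (Suc j) x" if w: "w \<in> gball K x (t j)" for w
  proof (rule step.IH)
    have "centre j i w \<in> gball j w (2 * R j)"
      using centre_ball ball_space[OF x w] by blast
    then have "centre j i w \<in> gball K w (2 * R j)"
      by (rule ball_mono) (use step in auto)
    then have "centre j i w \<in> gball K x (t j + 2 * R j)"
      by (rule ball_trans[OF x w])
    then show "centre j i w \<in> gball K x (t (Suc j))"
      by (rule ball_mono) (auto simp: t_Suc)
  qed
  then show ?case
    using step.prems ball_self[OF x, of K "t j"] by (simp add: i)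
qed

text \<open>The uniform displacement bound serves twice: it makes the fibres of
  \<open>stage n 0\<close> finite and keeps its kernel inside the orbit relation.\<close>

lemma stage_in_ball: "\<exists>m. \<forall>x\<in>space M. stage n k x \<in> gball n x m"
proof (induction "Suc n - k" arbitrary: k)
  case 0
  then show ?case
    using ball_self by (subst stage.simps) auto
next
  case (Suc d)
  then obtain m where m: "\<And>x. x \<in> space M \<Longrightarrow> stage n (Suc k) x \<in> gball n x m"
    by (metis Suc_diff_Suc diff_Suc_Suc nat.inject zero_less_Suc zero_less_diff)
  obtain i where i: "stage n k = stage n (Suc k) \<circ> centre k i"
    using stage_Suc[of k n] Suc.hyps(2) by auto
  have "stage n k x \<in> gball n x (2 * R k + m)" if x: "x \<in> space M" for x
  proof -
    have c: "centre k i x \<in> gball n x (2 * R k)"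
      by (rule ball_mono[OF centre_ball[OF x]]) (use Suc.hyps(2) in auto)
    show ?thesis
      using ball_trans[OF x c m[OF ball_space[OF x c]]] by (simp add: i)
  qed
  then show ?case
    by blast
qed

text \<open>The index at level \<open>k\<close> involves stages \<open>n' < n\<close> at level
  \<open>Suc k\<close>, so the induction varies \<open>n\<close> as well as
  \<open>k\<close>.\<close>

lemma measurable_stage: "stage n k \<in> measurable M M"
proof (induction "Suc n - k" arbitrary: n k rule: less_induct)
  case less
  show ?case
  proof (cases "n < k")
    case True
    then show ?thesis
      by (simp add: stage.simps[of n k] id_def)
  next
    case False
    have [measurable]: "Measurable.pred M (\<lambda>z. varies k (stage n' (Suc k)) z (5 * R k))"
      if "n' \<in> {k..<n}" for n'
      using less[of n' "Suc k"] that by (intro measurable_varies) auto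
    have "(\<lambda>z. \<Sum>n'=k..<n. if varies k (stage n' (Suc k)) z (5 * R k) then 1 else 0 :: nat)
      \<in> measurable M (count_space UNIV)"
      by measurable
    moreover have "stage n (Suc k) \<in> measurable M M"
      by (rule less) (use False in auto)
    ultimately show ?thesis
      using False stage_Suc[of k n] measurable_comp[OF measurable_centre] by simp
  qed
qed

end

section \<open>Hyperfiniteness of the orbit relation\<close>

lemma hyperfinite_if_eventually:
  assumes "equiv (space M) E" and fin: "\<And>n. finite_borel_equivalence_relation M (D n)"
    and sub: "\<And>n. D n \<subseteq> E"
    and ev: "\<And>x y. (x, y) \<in> E \<Longrightarrow> \<forall>\<^sub>F n in sequentially. (x, y) \<in> D n"
  shows "hyperfinite M E"
proof -
  define F where "F n = (\<Inter>m\<in>{n..}. D m)" for n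
  have eqv: "equiv (space M) (D m)" and meas: "D m \<in> sets (M \<Otimes>\<^sub>M M)" for m
    using fin by (auto simp: finite_borel_equivalence_relation_def borel_equivalence_relation_def)
  have eF: "equiv (space M) (F n)" for n
  proof (rule equivI)
    show "F n \<subseteq> space M \<times> space M"
      using equiv_type[OF eqv[of n]] by (auto simp: F_def)
    show "refl_on (space M) (F n)"
      using eqv by (auto simp: F_def refl_on_def equiv_def)
    show "sym (F n)"
      using eqv unfolding F_def by (auto simp: sym_def equiv_def)
    show "trans (F n)"
      unfolding F_def using eqv by (intro trans_INTER ballI) (auto simp: equiv_def)
  qed
  have "finite_borel_equivalence_relation M (F n)" for n
    unfolding finite_borel_equivalence_relation_def borel_equivalence_relation_def
  proof (intro conjI ballI eF)
    show "F n \<in> sets (M \<Otimes>\<^sub>M M)"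
      unfolding F_def using meas by (intro sets.countable_INT) auto
    fix C assume "C \<in> space M // F n"
    then obtain x where x: "x \<in> space M" "C = F n `` {x}"
      by (rule quotientE)
    have "finite (D n `` {x})"
      using fin[of n] x(1) by (auto simp: finite_borel_equivalence_relation_def quotientI)
    moreover have "C \<subseteq> D n `` {x}"
      using x by (auto simp: F_def)
    ultimately show "finite C"
      by (rule rev_finite_subset)
  qed
  moreover have "incseq F"
    unfolding F_def by (intro monoI INF_superset_mono) auto
  moreover have "E = (\<Union>n. F n)"
    using sub ev by (fastforce simp: F_def eventually_sequentially)
  ultimately show ?thesis
    unfolding hyperfinite_def using assms(1) by blast
qed

lemma (in group_action) equiv_orbit_equivalence_relation:
  "equiv E (orbit_equivalence_relation G E \<phi>)"
proof -
  interpret group G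
    using group_hom group_hom.axioms(1) by auto
  show ?thesis
  proof (rule equivI)
    show "refl_on E (orbit_equivalence_relation G E \<phi>)"
      using id_eq_one by (auto simp: refl_on_def orbit_equivalence_relation_def)
        (metis one_closed restrict_apply')
    show "sym (orbit_equivalence_relation G E \<phi>)"
      using orbit_sym_aux inv_closed unfolding orbit_equivalence_relation_def sym_def by blast
    show "trans (orbit_equivalence_relation G E \<phi>)"
    proof (rule transI)
      fix x y z
      assume "(x, y) \<in> orbit_equivalence_relation G E \<phi>" "(y, z) \<in> orbit_equivalence_relation G E \<phi>"
      then obtain g h where gh: "x \<in> E" "z \<in> E" "g \<in> carrier G" "h \<in> carrier G" "\<phi> g x = y" "\<phi> h y = z"
        by (auto simp: orbit_equivalence_relation_def)
      then have "\<phi> (h \<otimes> g) x = z"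
        using composition_rule by simp
      then show "(x, z) \<in> orbit_equivalence_relation G E \<phi>"
        using gh m_closed unfolding orbit_equivalence_relation_def by blast
    qed
  qed (auto simp: orbit_equivalence_relation_def)
qed

lemma (in standard_borel_action) finite_borel_kernel:
  assumes f: "f \<in> measurable M M" and fin: "\<And>y. finite {x \<in> space M. f x = y}"
  shows "finite_borel_equivalence_relation M {(x, y) \<in> space M \<times> space M. f x = f y}"
proof -
  let ?K = "{(x, y) \<in> space M \<times> space M. f x = f y}"
  have "Measurable.pred (M \<Otimes>\<^sub>M M) (\<lambda>p. f (fst p) = f (snd p))"
    by (intro pred_eq measurable_compose[OF measurable_fst f] measurable_compose[OF measurable_snd f])
  then have "?K \<in> sets (M \<Otimes>\<^sub>M M)"
    by (simp add: pred_def space_pair_measure case_prod_unfold mem_Times_iff)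
  moreover have "equiv (space M) ?K"
    by (rule equivI) (auto simp: refl_on_def sym_def trans_def)
  moreover have "finite C" if "C \<in> space M // ?K" for C
  proof -
    obtain x where "C = ?K `` {x}"
      using \<open>C \<in> space M // ?K\<close> by (rule quotientE)
    then have "C \<subseteq> {y \<in> space M. f y = f x}"
      by auto
    then show ?thesis
      using fin by (rule finite_subset)
  qed
  ultimately show ?thesis
    by (simp add: finite_borel_equivalence_relation_def borel_equivalence_relation_def)
qed

theorem (in scaled_action) hyperfinite_orbit_equivalence_relation:
  assumes A_exhausts: "carrier G \<subseteq> (\<Union>k. A k)" and t_pos: "1 \<le> t 0"
  shows "hyperfinite M (orbit_equivalence_relation G (space M) \<phi>)"
proof (rule hyperfinite_if_eventually)
  let ?D = "\<lambda>n. {(x, y) \<in> space M \<times> space M. stage n 0 x = stage n 0 y}"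
  show "equiv (space M) (orbit_equivalence_relation G (space M) \<phi>)"
    by (rule equiv_orbit_equivalence_relation)
  fix n
  obtain m where m: "\<And>x. x \<in> space M \<Longrightarrow> stage n 0 x \<in> gball n x m"
    using stage_in_ball by blast
  show "finite_borel_equivalence_relation M (?D n)"
  proof (rule finite_borel_kernel[OF measurable_stage])
    fix y
    have "{x \<in> space M. stage n 0 x = y} \<subseteq> gball n y m"
      using m ball_sym by blast
    then show "finite {x \<in> space M. stage n 0 x = y}"
      using ball_finite finite_subset by blast
  qed
  show "?D n \<subseteq> orbit_equivalence_relation G (space M) \<phi>"
  proof clarify
    fix x y assume xy: "x \<in> space M" "y \<in> space M" "stage n 0 x = stage n 0 y"
    have "stage n 0 y \<in> gball n x m" "y \<in> gball n (stage n 0 y) m"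
      using m[OF xy(1)] ball_sym[OF xy(2) m[OF xy(2)]] xy(3) by auto
    then have "y \<in> gball n x (m + m)"
      using ball_trans[OF xy(1)] by blast
    then show "(x, y) \<in> orbit_equivalence_relation G (space M) \<phi>"
      using xy P_closed by (auto simp: orbit_equivalence_relation_def gball_def)
  qed
next
  fix x y assume "(x, y) \<in> orbit_equivalence_relation G (space M) \<phi>"
  then obtain g where g: "x \<in> space M" "y \<in> space M" "g \<in> carrier G" "\<phi> g x = y"
    by (auto simp: orbit_equivalence_relation_def)
  \<comment> \<open>At this level \<open>y\<close> is within distance 1 of \<open>x\<close>.
    Whenever stage \<open>n\<close> does not vary near \<open>x\<close> here,
    \<open>stage_constant_below\<close> identifies \<open>x\<close> and \<open>y\<close> at level 0;
    that covers all but finitely many \<open>n\<close>.\<close>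
  then obtain k where "g \<in> A k"
    using A_exhausts by blast
  then have "y \<in> gball k x 1"
    using g(4) set_pow_one[OF A(2)] by (auto simp: gball_def)
  then have y: "y \<in> gball k x (t 0)"
    using ball_mono t_pos by blast
  have "\<forall>\<^sub>F n in sequentially. n \<notin> {n. k \<le> n \<and> varies k (stage n k) x (t k)}"
    using finite_varying_stages[OF g(1)] eventually_cofinite
    by (metis (mono_tags, lifting) cofinite_eq_sequentially finite_subset mem_Collect_eq not_not subsetI)
  then show "\<forall>\<^sub>F n in sequentially.
      (x, y) \<in> {(x, y) \<in> space M \<times> space M. stage n 0 x = stage n 0 y}"
    using eventually_ge_at_top[of k]
    by eventually_elim (use g y stage_constant_below[OF g(1) _ _ le0 y] in auto)
qed

section \<open>Separating families, growth and the choice of scales\<close>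

lemma standard_borel_separating:
  assumes "standard_borel_space M"
  shows "\<exists>S::nat \<Rightarrow> 'x set. (\<forall>i. S i \<in> sets (M :: 'x measure)) \<and>
    (\<forall>x\<in>space M. \<forall>y\<in>space M. x \<noteq> y \<longrightarrow> (\<exists>i. x \<in> S i \<and> y \<notin> S i))"
proof -
  obtain T where T: "completely_metrizable_space T" "separable_space T" "topspace T = space M"
    "sets M = sigma_sets (topspace T) {U. openin T U}"
    using assms by (auto simp: standard_borel_space_def)
  obtain X d where "Metric_space X d" and Td: "T = Metric_space.mtopology X d"
    using T(1) by (auto simp: completely_metrizable_space_def)
  then interpret Metric_space X d
    by simp
  have X: "X = space M"
    using T(3) Td by simp
  obtain C where C: "countable C" "C \<subseteq> X" "mtopology closure_of C = X"
    using T(2) by (auto simp: separable_space_def Td)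
  \<comment> \<open>The empty set keeps the family nonempty, as \<open>from_nat_into\<close>
    requires, even when \<open>C\<close> is empty.\<close>
  define \<B> where "\<B> = insert {} ((\<lambda>(c, n). mball c (inverse (real (Suc n)))) ` (C \<times> UNIV))"
  have \<B>: "countable \<B>" "\<B> \<noteq> {}"
    using C(1) by (auto simp: \<B>_def)
  have "U \<in> sets M" if "U \<in> \<B>" for U
    using that T(4) Td by (auto simp: \<B>_def intro!: sigma_sets.Basic)
  moreover have "\<exists>U\<in>\<B>. x \<in> U \<and> y \<notin> U" if "x \<in> space M" "y \<in> space M" "x \<noteq> y" for x y
  proof -
    have "d x y > 0"
      using that X by simp
    \<comment> \<open>A ball of radius below half of \<open>d x y\<close> cannot contain both
      points.\<close>
    then obtain n where n: "inverse (real (Suc n)) < d x y / 2"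
      using reals_Archimedean[of "d x y / 2"] by auto
    have "x \<in> mtopology closure_of C"
      using that X C by simp
    moreover have "0 < inverse (real (Suc n))"
      by simp
    ultimately obtain c where "c \<in> C" "c \<in> mball x (inverse (real (Suc n)))"
      unfolding metric_closure_of by blast
    then have c: "c \<in> C" "d x c < inverse (real (Suc n))"
      by (simp_all only: in_mball)
    have cX: "c \<in> X" "x \<in> X" "y \<in> X"
      using c(1) C(2) that X by auto
    have "x \<in> mball c (inverse (real (Suc n)))"
      unfolding in_mball using c(2) cX by (metis commute)
    moreover have "\<not> d c y < inverse (real (Suc n))"
      using triangle[OF cX(2,1,3)] c(2) n by linarith
    then have "y \<notin> mball c (inverse (real (Suc n)))"
      unfolding in_mball by blast
    ultimately show ?thesis
      using c(1) by (auto simp: \<B>_def)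
  qed
  ultimately show ?thesis
    using from_nat_into[OF \<B>(2)] from_nat_into_surj[OF \<B>(1)]
    by (intro exI[of _ "from_nat_into \<B>"]) metis
qed

lemma (in group) polynomial_growth_doubling:
  assumes poly: "\<And>H. subgroup H G \<Longrightarrow> finitely_generated (G\<lparr>carrier := H\<rparr>)
      \<Longrightarrow> polynomial_volume_growth (G\<lparr>carrier := H\<rparr>)"
    and B: "finite B" "B \<subseteq> carrier G" "\<one> \<in> B" "\<And>g. g \<in> B \<Longrightarrow> inv g \<in> B"
  shows "\<exists>b. \<forall>r0. \<exists>r\<ge>r0. card (set_pow G B (8 * r)) \<le> b * card (set_pow G B r)"
proof -
  define H where "H = generate G B"
  have H: "subgroup H G"
    unfolding H_def by (rule generate_is_subgroup[OF B(2)])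
  interpret K: group "G\<lparr>carrier := H\<rparr>"
    by (rule subgroup_imp_group[OF H])
  have BH: "B \<subseteq> H"
    unfolding H_def by (auto intro: generate.incl)
  have gen: "generate (G\<lparr>carrier := H\<rparr>) B = H"
    using generate_consistent[OF BH H] by (simp add: H_def)
  have "finite_symmetric_generating_set (G\<lparr>carrier := H\<rparr>) B"
    using B BH gen m_inv_consistent[OF H] by (auto simp: finite_symmetric_generating_set_def)
  moreover have "finitely_generated (G\<lparr>carrier := H\<rparr>)"
    using B(1) BH gen by (auto simp: finitely_generated_def)
  \<comment> \<open>Growth is given for some generating set of \<open>H\<close>;
    \<open>polynomial_volume_growth_iff_every\<close> transfers it to \<open>B\<close>.\<close>
  ultimately obtain d and c :: real
    where "\<And>r. r \<ge> 1 \<Longrightarrow> real (card (set_pow (G\<lparr>carrier := H\<rparr>) B r)) \<le> c * real r ^ d"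
    using poly[OF H] K.polynomial_volume_growth_iff_every by blast
  then have "real (card (set_pow G B r)) \<le> c * real r ^ d" if "r \<ge> 1" for r
    using that by (simp add: set_pow_subgroup)
  moreover have "card (set_pow G B r) \<ge> 1" for r
    using set_pow_finite[OF B(1)] one_mem_set_pow[OF B(2,3)]
    by (metis One_nat_def Suc_leI card_gt_0_iff empty_iff)
  ultimately show ?thesis
    by (rule polynomial_imp_doubling)
qed

lemma (in group) symmetric_exhaustion:
  assumes "countable (carrier G)"
  shows "\<exists>A :: nat \<Rightarrow> 'a set. (\<forall>k. finite (A k) \<and> A k \<subseteq> carrier G \<and> \<one> \<in> A k \<and>
    (\<forall>g\<in>A k. inv g \<in> A k) \<and> A k \<subseteq> A (Suc k)) \<and> carrier G \<subseteq> (\<Union>k. A k)"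
proof -
  define e where "e = from_nat_into (carrier G)"
  have ne: "carrier G \<noteq> {}"
    by auto
  have e: "e i \<in> carrier G" for i
    unfolding e_def by (rule from_nat_into[OF ne])
  have surj: "\<exists>i. e i = g" if "g \<in> carrier G" for g
    unfolding e_def using from_nat_into_surj[OF assms that] .
  let ?A = "\<lambda>k. insert \<one> (e ` {..k} \<union> (\<lambda>i. inv (e i)) ` {..k})"
  show ?thesis
  proof (intro exI[of _ ?A] conjI allI)
    show "carrier G \<subseteq> (\<Union>k. ?A k)"
      using surj by blast
  qed (use e in auto)
qed

theorem corollary1p12:
  fixes G :: "('g, 'm) monoid_scheme"
    and M :: "'x measure"
    and \<phi> :: "'g \<Rightarrow> 'x \<Rightarrow> 'x"
  assumes "group G"
    and "countable (carrier G)"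
    and "\<And>H. subgroup H G \<Longrightarrow> finitely_generated (G\<lparr>carrier := H\<rparr>)
      \<Longrightarrow> polynomial_volume_growth (G\<lparr>carrier := H\<rparr>)"
    and "standard_borel_space M"
    and "borel_action G M \<phi>"
  shows "hyperfinite M (orbit_equivalence_relation G (space M) \<phi>)"
proof -
  interpret group G by fact
  obtain A :: "nat \<Rightarrow> 'g set" where exhaustion:
    "(\<forall>k. finite (A k) \<and> A k \<subseteq> carrier G \<and> \<one>\<^bsub>G\<^esub> \<in> A k \<and>
      (\<forall>g\<in>A k. inv\<^bsub>G\<^esub> g \<in> A k) \<and> A k \<subseteq> A (Suc k)) \<and> carrier G \<subseteq> (\<Union>k. A k)"
    using symmetric_exhaustion[OF assms(2)] by (rule exE)
  then have A: "\<And>k. finite (A k)" "\<And>k. A k \<subseteq> carrier G" "\<And>k. \<one>\<^bsub>G\<^esub> \<in> A k"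
    "\<And>k g. g \<in> A k \<Longrightarrow> inv\<^bsub>G\<^esub> g \<in> A k" "\<And>k. A k \<subseteq> A (Suc k)" "carrier G \<subseteq> (\<Union>k. A k)"
    by simp_all
  have "\<exists>b. \<forall>r0. \<exists>r\<ge>r0. card (set_pow G (A k) (8 * r)) \<le> b * card (set_pow G (A k) r)" for k
    using polynomial_growth_doubling[OF assms(3) A(1-4)] by blast
  \<comment> \<open>All constants \<open>b k\<close> are fixed before any radius, because
    \<open>r k\<close> must be large compared with \<open>b (Suc k)\<close>.\<close>
  then obtain b where b:
    "\<And>k r0. \<exists>r\<ge>r0. card (set_pow G (A k) (8 * r)) \<le> b k * card (set_pow G (A k) r)"
    by metis
  define s where "s k r0 = (SOME r. r \<ge> r0 \<and>
    card (set_pow G (A k) (8 * r)) \<le> b k * card (set_pow G (A k) r))" for k r0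
  have s: "s k r0 \<ge> r0"
    "card (set_pow G (A k) (8 * s k r0)) \<le> b k * card (set_pow G (A k) (s k r0))" for k r0
    using someI_ex[OF b[where k = k and ?r0.0 = r0]] by (simp_all add: s_def)
  \<comment> \<open>\<open>r k\<close> depends on \<open>t k\<close>, and \<open>t (Suc k)\<close>
    on \<open>r k\<close>, so the recursion runs on \<open>t\<close> alone with \<open>r k\<close>
    written out. Starting at 1 lets the \<open>t 0\<close>-ball reach translates by single elements
    of \<open>A k\<close>.\<close>
  define t where "t = rec_nat 1 (\<lambda>k tk. tk + 10 * s k ((2 * tk + 1) * (b (Suc k) + 2)))"
  define r where "r k = s k ((2 * t k + 1) * (b (Suc k) + 2))" for k
  obtain S where S: "\<And>i. S i \<in> sets M"
    "\<And>x y. x \<in> space M \<Longrightarrow> y \<in> space M \<Longrightarrow> x \<noteq> y \<Longrightarrow> \<exists>i::nat. x \<in> S i \<and> y \<notin> S i"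
    using standard_borel_separating[OF assms(4)] by metis
  interpret scaled_action G M \<phi> S A b r t
  proof (intro scaled_action.intro standard_borel_action.intro
      standard_borel_action_axioms.intro scaled_action_axioms.intro)
    show "group_action G (space M) \<phi>"
      using assms(5) by (simp add: borel_action_def)
    show "\<phi> g \<in> measurable M M" if "g \<in> carrier G" for g
      using assms(5) that measurable_Pair2[of "\<lambda>(g, x). \<phi> g x" "count_space (carrier G)" M M g]
      by (simp add: borel_action_def)
    show "(2 * t k + 1) * (b (Suc k) + 2) \<le> 2 * r k" for k
      using s(1)[of "(2 * t k + 1) * (b (Suc k) + 2)" k] by (simp add: r_def)
    show "t (Suc k) = t k + 10 * r k" for k
      by (simp add: t_def r_def)
    show "card (set_pow G (A k) (8 * r k)) \<le> b k * card (set_pow G (A k) (r k))" for k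
      unfolding r_def by (rule s(2))
  qed (fact A S)+
  show ?thesis
    by (rule hyperfinite_orbit_equivalence_relation[OF conjunct2[OF exhaustion]])
      (simp add: t_def)
qed

end
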